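(* Let $a$ and $b$ be integers with $1 \leq a < b$ and $b \neq 2a$. Then \[ T(a,b) \leq \begin{cases} 7b^2 - 6ab + 13b - 10a & \text{if } b \text{ is even and } b > 2a, \\ 14b^{2} - 12ab + 26b - 20a & \text{if } b \text{ is odd and } b > 2a, \\ 3b^{2} + 2ab + 16a & \text{if } b \text{ is even and } b < 2a, \\ 6b^2 + 4ab + 8b + 16a & \text{if } b \text{ is odd and } b < 2a. \end{cases}\]
   Context: For positive integers $a \leq b$, an $(a,b)$-triple is a triple of the form $(x, ax+d, bx+2d)$, where $x$ and $d$ are positive integers. For a positive integer $r$, $T(a,b;r)$ denotes the least positive integer $n$ such that every $r$-coloring of $[1,n]=\{1,2,\ldots,n\}$ contains a monochromatic $(a,b)$-triple (that is, an $(a,b)$-triple all of whose terms lie in $[1,n]$ and have the same color); if no such $n$ exists, $T(a,b;r)=\infty$. The notation $T(a,b)$ abbreviates $T(a,b;2)$. In particular, the upper bound on $T(a,b)$ includes the assertion that $T(a,b)$ is finite. *)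

theory Defs
  imports Complex_Main "HOL-Library.FuncSet" "HOL-Library.Extended_Real"
begin

definition ab_triple :: "nat \<Rightarrow> nat \<Rightarrow> nat \<times> nat \<times> nat \<Rightarrow> bool" where
  "ab_triple a b t \<longleftrightarrow>
     (\<exists>x d. 1 \<le> x \<and> 1 \<le> d \<and> t = (x, a * x + d, b * x + 2 * d))"

definition has_mono_triple :: "nat \<Rightarrow> nat \<Rightarrow> nat \<Rightarrow> (nat \<Rightarrow> nat) \<Rightarrow> bool" where
  "has_mono_triple a b n c \<longleftrightarrow>
     (\<exists>x y z. ab_triple a b (x, y, z) \<and> {x, y, z} \<subseteq> {1..n} \<and> c x = c y \<and> c y = c z)"

definition forces :: "nat \<Rightarrow> nat \<Rightarrow> nat \<Rightarrow> nat \<Rightarrow> bool" where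
  "forces a b r n \<longleftrightarrow> (\<forall>c \<in> {1..n} \<rightarrow> {..<r}. has_mono_triple a b n c)"

definition T :: "nat \<Rightarrow> nat \<Rightarrow> nat \<Rightarrow> enat" where
  "T a b r =
     (if \<exists>n\<ge>1. forces a b r n then enat (LEAST n. 1 \<le> n \<and> forces a b r n) else \<infinity>)"

abbreviation T2 :: "nat \<Rightarrow> nat \<Rightarrow> enat" where
  "T2 a b \<equiv> T a b 2"

end

theory Submission
  imports Defs
begin

text \<open>
  Write an \<open>(a,b)\<close>-triple as \<open>(x, y, 2y + (b - 2a)x)\<close> with \<open>y > ax\<close>. Let \<open>s = 1\<close> if \<open>b\<close> is even and
  \<open>s = 2\<close> if \<open>b\<close> is odd, and put \<open>p = s(b - 2a)/2\<close>, a nonzero integer. The triples whose first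
  term is \<open>sj\<close> are then \<open>(sj, y, 2y + 2pj)\<close>.

  Suppose that a 2-colouring has no monochromatic triple. The triple \<open>(s, s(a+1), s(b+2))\<close> shows
  that the colour changes between \<open>si\<close> and \<open>s(i+1)\<close> for some \<open>i \<le> b + 1\<close>. Let \<open>j, k\<close> be these two
  indices \<open>i, i+1\<close>, named in the order that makes \<open>q = p(j - k)\<close> positive. The triples
  \<open>(sj, y, z)\<close> and \<open>(sk, y+q, z)\<close> with \<open>z = 2y + 2pj\<close> have the same last term. If \<open>y\<close> has the colour
  of \<open>sj\<close>, then \<open>z\<close> has the colour of \<open>sk\<close>, and so \<open>y + q\<close> has the colour of \<open>sj\<close> again: this
  colour climbs in steps of \<open>q\<close> (\<open>colour_climbs\<close>).

  Among the multiples of \<open>q\<close> this is fatal. If a multiple \<open>y > as(i+1)\<close> has the colour of \<open>sj\<close>, then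
  so does the larger multiple \<open>2y + 2pj\<close>, and \<open>(sj, y, 2y + 2pj)\<close> is monochromatic. Hence the
  least multiple \<open>Y > as(i+1)\<close> of \<open>q\<close> has the colour of \<open>sk\<close>; then \<open>Z = 2Y + 2pk\<close> is a multiple of \<open>q\<close> above \<open>Y\<close>
  with the colour of \<open>sj\<close>, which is impossible by the same argument (\<open>two_colouring_contradiction\<close>).
  The largest number used is \<open>8Y + 10pk + 4pj\<close>, with \<open>Y \<le> as(i+1) + q\<close> and \<open>i \<le> b + 1\<close>. For
  \<open>b > 2a\<close> this gives exactly the stated bounds; for \<open>b < 2a\<close> it gives \<open>s(7b\<^sup>2 - 6ab + 8b)\<close>, which lies
  below them.
\<close>

text \<open>
  The difference of the two sides is \<open>(y - a * x) + (b - a) * x\<close>. Thanks to this, a bound on the last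
  term of a triple also bounds its middle term, and for \<open>a \<ge> 1\<close> its first.
\<close>

lemma last_term_larger:
  fixes a b x y :: int
  assumes "a \<le> b" "0 \<le> x" "a * x < y"
  shows "y < 2 * y + (b - 2 * a) * x"
proof -
  have "a * x \<le> b * x" using assms by (intro mult_right_mono) auto
  with assms(3) show ?thesis by (simp add: algebra_simps)
qed

text \<open>
  Two triples that share their last term transport the colour of \<open>s * j\<close> from \<open>y\<close> to \<open>y + q\<close>.
  The step from \<open>M - q\<close> to \<open>M\<close> uses the last term \<open>2 * (M - q) + 2 * p * j\<close>, which is
  \<open>2 * M + 2 * p * k\<close>; this explains the bound on \<open>N\<close>.
\<close>

lemma colour_climbs:
  fixes f :: "int \<Rightarrow> bool" and a b s p j k q B N M y :: int and n :: nat
  assumes sp: "s * (b - 2 * a) = 2 * p"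
    and avoid: "\<And>x y. 1 \<le> x \<Longrightarrow> a * x < y \<Longrightarrow> 2 * y + (b - 2 * a) * x \<le> N
      \<Longrightarrow> \<not> (f x = f y \<and> f y = f (2 * y + (b - 2 * a) * x))"
    and pos: "1 \<le> s * j" "1 \<le> s * k"
    and differ: "f (s * j) \<noteq> f (s * k)"
    and q: "q = p * (j - k)" "0 < q"
    and B: "a * (s * j) \<le> B" "a * (s * k) \<le> B"
    and N: "2 * M + 2 * p * k \<le> N"
    and start: "B < y" "f y = f (s * j)"
    and fits: "y + int n * q \<le> M"
  shows "f (y + int n * q) = f (s * j)"
  using fits
proof (induction n)
  case 0
  then show ?case using start by simp
next
  case (Suc n)
  define w where "w = y + int n * q"
  have w_next: "y + int (Suc n) * q = w + q" by (simp add: w_def algebra_simps)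
  have "0 \<le> int n * q" using q(2) by simp
  hence "B < w" using start(1) by (simp add: w_def)
  have fw: "f w = f (s * j)"
    using Suc q(2) unfolding w_next by (simp add: w_def)
  have sx: "(b - 2 * a) * (s * x) = 2 * p * x" for x
  proof -
    have "(b - 2 * a) * (s * x) = (s * (b - 2 * a)) * x" by (simp only: mult_ac)
    then show ?thesis by (simp only: sp)
  qed
  have shared: "2 * (w + q) + 2 * p * k = 2 * w + 2 * p * j"
    unfolding q(1) by (simp add: algebra_simps)
  have le: "2 * w + 2 * p * j \<le> N"
  proof -
    have "2 * (w + q) + 2 * p * k \<le> 2 * M + 2 * p * k"
      using Suc.prems unfolding w_next by simp
    with N show ?thesis unfolding shared by (rule order_trans[rotated])
  qed
  have "f (2 * w + 2 * p * j) \<noteq> f (s * j)"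
    using avoid[of "s * j" w] pos(1) B(1) \<open>B < w\<close> fw le by (simp add: sx)
  moreover have "\<not> (f (s * k) = f (w + q) \<and> f (w + q) = f (2 * w + 2 * p * j))"
    using avoid[of "s * k" "w + q"] pos(2) B(2) \<open>B < w\<close> q(2) le unfolding sx shared by linarith
  ultimately show ?case using differ unfolding w_next by blast
qed

text \<open>
  A colour change between \<open>s * j\<close> and \<open>s * k\<close> already rules out a colouring without monochromatic
  triples. No multiple of \<open>q\<close> above \<open>B\<close> can have the colour that climbs, as long as its climb
  ends by \<open>M\<close>; but of \<open>Y\<close> and \<open>Z\<close> one must have it, because otherwise \<open>(s * k, Y, Z)\<close> is
  monochromatic.
\<close>

lemma two_colouring_contradiction:
  fixes f :: "int \<Rightarrow> bool" and a b s p j k q B N :: int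
  assumes ab: "a \<le> b"
    and sp: "s * (b - 2 * a) = 2 * p"
    and avoid: "\<And>x y. 1 \<le> x \<Longrightarrow> a * x < y \<Longrightarrow> 2 * y + (b - 2 * a) * x \<le> N
      \<Longrightarrow> \<not> (f x = f y \<and> f y = f (2 * y + (b - 2 * a) * x))"
    and pos: "1 \<le> s * j" "1 \<le> s * k"
    and differ: "f (s * j) \<noteq> f (s * k)"
    and q: "q = p * (j - k)" "0 < q" "q dvd p"
    and B: "a * (s * j) \<le> B" "a * (s * k) \<le> B"
    and N: "8 * B + 8 * q + 10 * p * k + 4 * p * j \<le> N"
  shows False
proof -
  define Y where "Y = q * (B div q + 1)"
  define Z where "Z = 2 * Y + 2 * p * k"
  define M where "M = 2 * Z + 2 * p * j"
  have "Y = B - B mod q + q"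
    unfolding Y_def by (simp add: minus_mod_eq_mult_div distrib_left)
  hence Y: "B < Y" "Y \<le> B + q"
    using pos_mod_bound[OF q(2), of B] pos_mod_sign[OF q(2), of B] by linarith+
  have sx: "(b - 2 * a) * (s * x) = 2 * p * x" for x
  proof -
    have "(b - 2 * a) * (s * x) = (s * (b - 2 * a)) * x" by (simp only: mult_ac)
    then show ?thesis by (simp only: sp)
  qed
  have larger_j: "y < 2 * y + 2 * p * j" if "B < y" for y
    using last_term_larger[OF ab, of "s * j" y] pos(1) B(1) that by (simp add: sx)
  have "Y < Z"
    using last_term_larger[OF ab, of "s * k" Y] pos(2) B(2) Y(1) by (simp add: sx Z_def)
  hence "B < Z" using Y(1) by simp
  hence "Z < M" using larger_j by (simp add: M_def)
  have last: "2 * M + 2 * p * k \<le> N"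
    using N Y(2) unfolding M_def Z_def by (simp add: algebra_simps)
  have "B < M" using \<open>B < Z\<close> \<open>Z < M\<close> by simp
  have "M \<le> N"
    using last_term_larger[OF ab, of "s * k" M] pos(2) B(2) \<open>B < M\<close> last by (simp add: sx)
  have dvd_Y: "q dvd Y" by (simp add: Y_def)
  hence dvd_Z: "q dvd Z" using q(3) by (simp add: Z_def)
  have not_climber: "f y \<noteq> f (s * j)" if y: "B < y" "q dvd y" "2 * y + 2 * p * j \<le> M" for y
  proof
    assume fy: "f y = f (s * j)"
    have "q dvd y + 2 * p * j" using y(2) q(3) by simp
    then obtain t where t: "y + 2 * p * j = q * t" by (auto elim: dvdE)
    have "0 < q * t" using larger_j[OF y(1)] t by simp
    hence "0 < t" using q(2) by (simp add: zero_less_mult_iff)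
    hence top: "y + int (nat t) * q = 2 * y + 2 * p * j"
      using t by (simp add: algebra_simps)
    have "f (y + int (nat t) * q) = f (s * j)"
      by (rule colour_climbs[OF sp avoid pos differ q(1,2) B last y(1) fy]) (use top y(3) in simp_all)
    then show False
      using avoid[of "s * j" y] pos(1) B(1) y(1,3) fy \<open>M \<le> N\<close> unfolding top sx by linarith
  qed
  have "f Y \<noteq> f (s * j)"
    using not_climber[OF Y(1) dvd_Y] \<open>Y < Z\<close> by (simp add: M_def)
  moreover have "f Z \<noteq> f (s * j)"
    using not_climber[OF \<open>B < Z\<close> dvd_Z] by (simp add: M_def)
  moreover have "\<not> (f (s * k) = f Y \<and> f Y = f Z)"
    using avoid[of "s * k" Y] pos(2) B(2) Y(1) \<open>Z < M\<close> \<open>M \<le> N\<close> unfolding sx Z_def by simp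
  ultimately show False using differ by blast
qed

lemma adjacent_colour_change:
  fixes f :: "int \<Rightarrow> bool" and a b s N :: int
  assumes "1 \<le> a" "a \<le> b" "1 \<le> s" "s * (b + 2) \<le> N"
    and avoid: "\<And>x y. 1 \<le> x \<Longrightarrow> a * x < y \<Longrightarrow> 2 * y + (b - 2 * a) * x \<le> N
      \<Longrightarrow> \<not> (f x = f y \<and> f y = f (2 * y + (b - 2 * a) * x))"
  obtains i where "1 \<le> i" "i \<le> b + 1" "f (s * i) \<noteq> f (s * (i + 1))"
proof (rule ccontr)
  assume "\<not> thesis"
  with that have const: "f (s * i) = f (s * (i + 1))" if "1 \<le> i" "i \<le> b + 1" for i
    using that by blast
  have same: "i \<le> b + 2 \<longrightarrow> f (s * i) = f s" if "1 \<le> i" for i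
    using that by (induction i rule: int_ge_induct) (use const in auto)
  have "2 * (s * (a + 1)) + (b - 2 * a) * s = s * (b + 2)" by (simp add: algebra_simps)
  then have "\<not> (f s = f (s * (a + 1)) \<and> f (s * (a + 1)) = f (s * (b + 2)))"
    using avoid[of s "s * (a + 1)"] assms(3,4) by (simp add: algebra_simps)
  then show False using same[of "a + 1"] same[of "b + 2"] assms(1,2) by simp
qed

text \<open>
  The hypothesis on \<open>N\<close> is what \<open>two_colouring_contradiction\<close> needs at a colour change between
  \<open>s * (b + 1)\<close> and \<open>s * (b + 2)\<close>, the latest possible one. As a function of the position \<open>i\<close> of the
  change, the requirement has slope \<open>8 * a * s + 14 * p = s * (7 * b - 6 * a) > 0\<close>, so an earlier change
  needs less. For \<open>p > 0\<close> the colour of \<open>s * (i + 1)\<close> climbs, for \<open>p < 0\<close> that of \<open>s * i\<close>; this is the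
  source of the two constants \<open>12\<close> and \<open>2\<close>.
\<close>

lemma forces_two_colours:
  fixes a b N :: nat and s p :: int
  assumes ab: "1 \<le> a" "a < b" and s: "1 \<le> s"
    and sp: "s * (int b - 2 * int a) = 2 * p" and "p \<noteq> 0"
    and N: "8 * int a * s * (int b + 2) + 14 * p * (int b + 1) + (if 0 < p then 12 * p else 2 * p) \<le> int N"
  shows "forces a b 2 N"
  unfolding forces_def
proof (rule ballI, rule ccontr)
  fix c assume c: "c \<in> {1..N} \<rightarrow> {..<2::nat}" and none: "\<not> has_mono_triple a b N c"
  define f where "f x = (c (nat x) = 0)" for x :: int
  define A B where "A = int a" and "B = int b"
  have AB: "1 \<le> A" "A < B" using ab by (simp_all add: A_def B_def)
  have sp': "s * (B - 2 * A) = 2 * p" using sp by (simp add: A_def B_def)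
  have slope_eq: "8 * A * s + 14 * p = s * (7 * B - 6 * A)"
    using sp' by (simp add: algebra_simps)
  have slope: "0 \<le> 8 * A * s + 14 * p"
    unfolding slope_eq using AB s by simp
  have avoid: "\<not> (f x = f y \<and> f y = f (2 * y + (B - 2 * A) * x))"
    if x: "1 \<le> x" and y: "A * x < y" and z: "2 * y + (B - 2 * A) * x \<le> int N" for x y
  proof
    let ?z = "2 * y + (B - 2 * A) * x"
    assume mono: "f x = f y \<and> f y = f ?z"
    have "y < ?z" using last_term_larger[of A B x y] AB x y by simp
    moreover have "x < y"
    proof -
      have "1 * x \<le> A * x" using AB x by (intro mult_right_mono) auto
      with y show ?thesis by simp
    qed
    ultimately have range: "nat x \<in> {1..N}" "nat y \<in> {1..N}" "nat ?z \<in> {1..N}"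
      using x z by auto
    have two: "c u = 0 \<or> c u = 1" if "u \<in> {1..N}" for u
    proof -
      have "c u < 2" using c that by auto
      then show ?thesis by linarith
    qed
    have "c (nat x) = c (nat y)" "c (nat y) = c (nat ?z)"
      using mono range[THEN two] by (auto simp: f_def)
    moreover have "ab_triple a b (nat x, nat y, nat ?z)"
    proof -
      have "nat y = a * nat x + nat (y - A * x)"
      proof -
        have "int (a * nat x + nat (y - A * x)) = y" using x y by (simp add: A_def)
        then show ?thesis by (metis nat_int)
      qed
      moreover have "nat ?z = b * nat x + 2 * nat (y - A * x)"
      proof -
        have "int (b * nat x + 2 * nat (y - A * x)) = ?z"
          using x y by (simp add: A_def B_def algebra_simps)
        then show ?thesis by (metis nat_int)
      qed
      moreover have "1 \<le> nat x" "1 \<le> nat (y - A * x)" using x y by auto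
      ultimately show ?thesis unfolding ab_triple_def by blast
    qed
    ultimately show False using none range unfolding has_mono_triple_def by blast
  qed
  have N': "8 * A * s * (B + 2) + 14 * p * (B + 1) + (if 0 < p then 12 * p else 2 * p) \<le> int N"
    using N by (simp add: A_def B_def)
  have "s * (B + 2) \<le> int N"
  proof -
    (* The left side of N' is (8 * A * s + 14 * p) * (B + 1) plus 8 * A * s and either 12 * p or 2 * p;
       the last summand is negative only for p < 0, and then 8 * A * s outweighs it. *)
    have "2 * p \<ge> - (s * A)"
    proof -
      have "s * (B - 2 * A) \<ge> s * (- A)" using AB s by (intro mult_left_mono) auto
      with sp' show ?thesis by simp
    qed
    moreover have "8 * A * s + 14 * p \<ge> s * (B + 6)"
      unfolding slope_eq using AB s by (intro mult_left_mono) auto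
    hence "(8 * A * s + 14 * p) * (B + 1) \<ge> s * (B + 6) * 1"
      using slope AB s by (intro mult_mono) auto
    moreover have "0 \<le> s * A" using AB s by simp
    ultimately show ?thesis using N' s by (auto simp: algebra_simps split: if_splits)
  qed
  then obtain i where i: "1 \<le> i" "i \<le> B + 1" "f (s * i) \<noteq> f (s * (i + 1))"
    using adjacent_colour_change[of A B s "int N" f] AB s avoid by (metis less_imp_le)
  have pos: "1 \<le> s * i" "1 \<le> s * (i + 1)"
    using mult_mono[of 1 s 1 i] mult_mono[of 1 s 1 "i + 1"] s i(1) by simp_all
  have "s * i \<le> s * (i + 1)" using s by simp
  hence bnd: "A * (s * i) \<le> A * (s * (i + 1))" using AB(1) by (simp add: mult_left_mono)
  have grow: "(8 * A * s + 14 * p) * i \<le> (8 * A * s + 14 * p) * (B + 1)"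
    using slope i(2) by (intro mult_left_mono) auto
  show False
  proof (cases "0 < p")
    case True
    show False
    proof (rule two_colouring_contradiction[of A B s p "int N" f "i + 1" i p "A * (s * (i + 1))"])
      show "8 * (A * (s * (i + 1))) + 8 * p + 10 * p * i + 4 * p * (i + 1) \<le> int N"
        using N' grow True by (simp add: algebra_simps)
    qed (use AB sp' avoid pos i True bnd in auto)
  next
    case False
    with \<open>p \<noteq> 0\<close> have "p < 0" by simp
    show False
    proof (rule two_colouring_contradiction[of A B s p "int N" f i "i + 1" "- p" "A * (s * (i + 1))"])
      show "8 * (A * (s * (i + 1))) + 8 * (- p) + 10 * p * (i + 1) + 4 * p * i \<le> int N"
        using N' grow False by (simp add: algebra_simps)
    qed (use AB sp' avoid pos i \<open>p < 0\<close> bnd in auto)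
  qed
qed

lemma T2_le_of_forces:
  assumes "1 \<le> n" "forces a b 2 n"
  shows "ereal_of_enat (T2 a b) \<le> ereal (real n)"
proof -
  have "(LEAST n. 1 \<le> n \<and> forces a b 2 n) \<le> n" using assms by (intro Least_le) simp
  then show ?thesis using assms unfolding T_def by auto
qed

text \<open>
  Substituting \<open>2 * p = s * (b - 2 * a)\<close> turns the threshold of \<open>forces_two_colours\<close> into \<open>s\<close> times a
  polynomial in \<open>a\<close> and \<open>b\<close>. Parity of \<open>b\<close> enters only through the need for \<open>s * b\<close> to be even.
\<close>

lemma T2_le_scaled:
  fixes a b :: nat and s :: int and R :: int
  assumes ab: "1 \<le> a" "a < b" "b \<noteq> 2 * a" and s: "1 \<le> s" "even (s * int b)"
    and R: "s * (if 2 * a < b then 7 * int b ^ 2 - 6 * int a * int b + 13 * int b - 10 * int a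
                  else 7 * int b ^ 2 - 6 * int a * int b + 8 * int b) \<le> R"
  shows "ereal_of_enat (T2 a b) \<le> ereal (real_of_int R)"
proof -
  define A B where "A = int a" and "B = int b"
  have AB: "1 \<le> A" "A < B" "B \<noteq> 2 * A" using ab by (auto simp: A_def B_def)
  have "even (s * (B - 2 * A))" using s(2) by (simp add: B_def)
  then obtain p where p: "s * (B - 2 * A) = 2 * p" by (rule evenE)
  have "p \<noteq> 0" using p AB s(1) by auto
  have sign: "0 < p \<longleftrightarrow> 2 * a < b"
  proof -
    have "0 < p \<longleftrightarrow> 0 < s * (B - 2 * A)" using p by simp
    also have "\<dots> \<longleftrightarrow> 2 * A < B" using s(1) by (auto simp: zero_less_mult_iff)
    finally show ?thesis by (auto simp: A_def B_def)
  qed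
  define P where "P = (if 2 * a < b then 7 * B ^ 2 - 6 * A * B + 13 * B - 10 * A
                       else 7 * B ^ 2 - 6 * A * B + 8 * B)"
  have thr: "8 * A * s * (B + 2) + 14 * p * (B + 1) + (if 0 < p then 12 * p else 2 * p) = s * P"
  proof -
    have "14 * p * (B + 1) = 7 * (s * (B - 2 * A)) * (B + 1)"
      "12 * p = 6 * (s * (B - 2 * A))" "2 * p = s * (B - 2 * A)"
      unfolding p by simp_all
    then show ?thesis
      by (simp add: P_def sign power2_eq_square algebra_simps del: mult_cancel_left)
  qed
  have "1 \<le> P"
  proof -
    have "A * B \<le> B * B" using AB by (intro mult_right_mono) auto
    moreover have "0 \<le> B * B" by simp
    ultimately have "0 \<le> 7 * B ^ 2 - 6 * A * B"
      unfolding power2_eq_square mult.assoc by linarith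
    then show ?thesis
      unfolding P_def using AB by (split if_split, intro conjI impI; linarith)
  qed
  hence "1 * 1 \<le> s * P" using s(1) by (intro mult_mono) auto
  moreover have sP: "s * P \<le> R" using R unfolding P_def A_def B_def .
  ultimately have "1 \<le> R" by linarith
  have "forces a b 2 (nat R)"
    using forces_two_colours[OF ab(1,2) s(1) _ \<open>p \<noteq> 0\<close>, of "nat R"] p thr sP \<open>1 \<le> R\<close>
    unfolding A_def B_def by simp
  with T2_le_of_forces[of "nat R" a b] \<open>1 \<le> R\<close> show ?thesis by simp
qed

theorem theorem2:
  fixes a b :: nat
  assumes "1 \<le> a" and "a < b" and "b \<noteq> 2 * a"
  shows "ereal_of_enat (T2 a b) \<le> ereal
    (if b > 2 * a then
       (if even b
        then 7 * real b ^ 2 - 6 * real a * real b + 13 * real b - 10 * real a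
        else 14 * real b ^ 2 - 12 * real a * real b + 26 * real b - 20 * real a)
     else
       (if even b
        then 3 * real b ^ 2 + 2 * real a * real b + 16 * real a
        else 6 * real b ^ 2 + 4 * real a * real b + 8 * real b + 16 * real a))"
proof -
  define R where "R = (if b > 2 * a then
       (if even b
        then 7 * int b ^ 2 - 6 * int a * int b + 13 * int b - 10 * int a
        else 14 * int b ^ 2 - 12 * int a * int b + 26 * int b - 20 * int a)
     else
       (if even b
        then 3 * int b ^ 2 + 2 * int a * int b + 16 * int a
        else 6 * int b ^ 2 + 4 * int a * int b + 8 * int b + 16 * int a))"
  (* for odd b only even first terms x = 2j are used, so that p is an integer; this doubles
     the numbers that occur *)
  define s :: int where "s = (if even b then 1 else 2)"
  have "ereal_of_enat (T2 a b) \<le> ereal (real_of_int R)"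
  proof (rule T2_le_scaled[OF assms, of s])
    show "1 \<le> s" "even (s * int b)" by (auto simp: s_def)
    (* for b < 2a the slack is 4 (b + 2) (2a - b) if b is even and 8 (b + 1) (2a - b) if b is odd *)
    have slack: "int b * int b \<le> 2 * (int a * int b)" if "\<not> 2 * a < b"
      using mult_right_mono[of "int b" "2 * int a" "int b"] that by simp
    show "s * (if 2 * a < b then 7 * int b ^ 2 - 6 * int a * int b + 13 * int b - 10 * int a
               else 7 * int b ^ 2 - 6 * int a * int b + 8 * int b) \<le> R"
      using slack by (auto simp: R_def s_def power2_eq_square algebra_simps)
  qed
  also have "real_of_int R = (if b > 2 * a then
       (if even b
        then 7 * real b ^ 2 - 6 * real a * real b + 13 * real b - 10 * real a
        else 14 * real b ^ 2 - 12 * real a * real b + 26 * real b - 20 * real a)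
     else
       (if even b
        then 3 * real b ^ 2 + 2 * real a * real b + 16 * real a
        else 6 * real b ^ 2 + 4 * real a * real b + 8 * real b + 16 * real a))"
    by (simp add: R_def)
  finally show ?thesis .
qed

end
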